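(* Let $\mu$ be a Carleson measure on $\mathbb{R}^2_+$. Then $$\mathrm{Carl}(\mu)\;\approx\;\sup_{E\subseteq\mathbb{R}^2_+,\ E\text{ Borel set}}\|S^d_{\mu_E}\|_{\mathrm{BMO}^d}\;\approx\;\sup_{I\in\mathcal{D}}\|S^d_{\mu_{Q_I}}\|_{\mathrm{BMO}^d}.$$ Here, $\mu_E$ stands for the restriction of $\mu$ to $E$, given by $\mu_E(A)=\mu(E\cap A)$, and $\approx$ denotes a two-sided estimate up to an absolute constant.
   Context: $\mathbb{R}^2_+ = \{(x,y)\in\mathbb{R}^2 : y>0\}$ is the upper half-plane. Measures on $\mathbb{R}^2_+$ are positive regular Borel measures. For an interval $I\subset\mathbb{R}$ of length $|I|$, the Carleson square over $I$ is $Q_I=\{(x,y): x\in I,\ 0<y\le |I|\}$. $\mathcal{D}$ denotes the set of left-half-open dyadic intervals in $\mathbb{R}$. For $I\in\mathcal{D}$, $T_I=\{(x,y): x\in I,\ |I|/2<y\le |I|\}$ is the top half of $Q_I$. A measure $\mu$ is a Carleson measure if there is a constant $C>0$ with $\mu(Q_I)\le C|I|$ for each interval $I\subset\mathbb{R}$ (it is sufficient to consider dyadic intervals). $\mathrm{Carl}(\mu)$ is the infimum of all $C>0$ such that $\mu(Q_I)\le C|I|$ for all $I\in\mathcal{D}$. The dyadic balayage of a measure $\mu$ is the $[0,\infty]$-valued function $S^d_\mu(t)=\sum_{I\in\mathcal{D}}\frac{\chi_I(t)}{|I|}\mu(T_I)$, $t\in\mathbb{R}$. Dyadic BMO, $\mathrm{BMO}^d(\mathbb{R})$,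 is the class of functions $b\in L^2(\mathbb{R})$ for which $\|b\|_{\mathrm{BMO}^d}^2=\sup_{I\in\mathcal{D}}\frac1{|I|}\int_I|b(t)-\langle b\rangle_I|^2\,dt$ is finite, where $\langle b\rangle_I=\frac1{|I|}\int_I b(t)\,dt$. (By the John-Nirenberg inequality, the $L^2$ norm in this definition can be replaced by any $L^p$ norm, $1\le p<\infty$, yielding an equivalent norm.)
   Formalization: The BMO^d norm is taken by the displayed oscillation formula without requiring membership in L^2; on dyadic intervals where the balayage is a.e. infinite (possible for Carleson measures of infinite mass, where the formula is undefined) the oscillation is taken as 0. *)

theory Defs
  imports "HOL-Analysis.Analysis"
begin

definition upper_half_plane :: "(real \<times> real) set" where
  "upper_half_plane = {(x, y). 0 < y}"

abbreviation len :: "real set \<Rightarrow> real" where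
  "len I \<equiv> measure lborel I"

definition carleson_square :: "real set \<Rightarrow> (real \<times> real) set" where
  "carleson_square I = {(x, y). x \<in> I \<and> 0 < y \<and> y \<le> len I}"

definition top_half :: "real set \<Rightarrow> (real \<times> real) set" where
  "top_half I = {(x, y). x \<in> I \<and> len I / 2 < y \<and> y \<le> len I}"

definition dyadic_intervals :: "real set set" where
  "dyadic_intervals = {{of_int k * 2 powi n <.. (of_int k + 1) * 2 powi n} | k n :: int. True}"

text \<open>The open subsets of the half-plane in its subspace topology are the open subsets of the
  plane that are contained in it, so both regularity conditions can be written with the
  topology of the plane.\<close>

definition regular_borel_measure_uhp :: "(real \<times> real) measure \<Rightarrow> bool" where
  "regular_borel_measure_uhp \<mu> \<longleftrightarrow>
     sets \<mu> = sets (restrict_space borel upper_half_plane) \<and>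
     (\<forall>A\<in>sets \<mu>. emeasure \<mu> A =
        (INF U\<in>{U. open U \<and> A \<subseteq> U \<and> U \<subseteq> upper_half_plane}. emeasure \<mu> U)) \<and>
     (\<forall>A\<in>sets \<mu>. emeasure \<mu> A = (SUP K\<in>{K. compact K \<and> K \<subseteq> A}. emeasure \<mu> K))"

text \<open>Only bounded intervals matter: for an unbounded one the bound is infinite, whereas
  \<open>len\<close> would be \<open>0\<close> by totalization.\<close>

definition carleson_measure :: "(real \<times> real) measure \<Rightarrow> bool" where
  "carleson_measure \<mu> \<longleftrightarrow> regular_borel_measure_uhp \<mu> \<and>
     (\<exists>C>0. \<forall>I. is_interval I \<and> bounded I \<longrightarrow>
        emeasure \<mu> (carleson_square I) \<le> ennreal (C * len I))"

definition Carl :: "(real \<times> real) measure \<Rightarrow> ennreal" where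
  "Carl \<mu> = (INF C\<in>{C. 0 < C \<and>
     (\<forall>I\<in>dyadic_intervals. emeasure \<mu> (carleson_square I) \<le> ennreal (C * len I))}. ennreal C)"

definition restrict_measure :: "'a measure \<Rightarrow> 'a set \<Rightarrow> 'a measure" where
  "restrict_measure \<mu> E = measure_of (space \<mu>) (sets \<mu>) (\<lambda>A. emeasure \<mu> (E \<inter> A))"

lemma sets_restrict_measure [simp]: "sets (restrict_measure \<mu> E) = sets \<mu>"
  by (simp add: restrict_measure_def)

lemma emeasure_restrict_measure:
  assumes "E \<in> sets \<mu>" "A \<in> sets \<mu>"
  shows "emeasure (restrict_measure \<mu> E) A = emeasure \<mu> (E \<inter> A)"
proof -
  have "restrict_measure \<mu> E = density \<mu> (indicator E)"
    unfolding restrict_measure_def density_def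
    by (rule measure_of_eq[OF sets.space_closed])
      (use assms in \<open>simp add: sets.sigma_sets_eq emeasure_density[symmetric] emeasure_restricted
        flip: density_def\<close>)
  then show ?thesis
    using assms by (simp add: emeasure_restricted)
qed

definition dyadic_balayage :: "(real \<times> real) measure \<Rightarrow> real \<Rightarrow> ennreal" where
  "dyadic_balayage \<mu> t =
     (\<Sum>\<^sub>\<infinity>I\<in>dyadic_intervals. indicator I t / ennreal (len I) * emeasure \<mu> (top_half I))"

definition mean :: "(real \<Rightarrow> real) \<Rightarrow> real set \<Rightarrow> real" where
  "mean b I = (LINT t:I|lborel. b t) / len I"

definition square_oscillation :: "(real \<Rightarrow> real) \<Rightarrow> real set \<Rightarrow> ennreal" where
  "square_oscillation b I =
     (\<integral>\<^sup>+t\<in>I. ennreal (\<bar>b t - mean b I\<bar>\<^sup>2) \<partial>lborel) / ennreal (len I)"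

text \<open>Balayages take values in \<open>[0, \<infinity>]\<close>. A function that is finite almost everywhere on
  \<open>I\<close> is identified there with a real function. The balayage of an infinite Carleson measure
  can also be identically \<open>\<infinity>\<close> on a half-line; there it is a constant, and constants do not
  oscillate. In every other case the oscillation is infinite.\<close>

definition ext_square_oscillation :: "(real \<Rightarrow> ennreal) \<Rightarrow> real set \<Rightarrow> ennreal" where
  "ext_square_oscillation f I =
     (if AE t in lborel. t \<in> I \<longrightarrow> f t < \<infinity> then square_oscillation (\<lambda>t. enn2real (f t)) I
      else if AE t in lborel. t \<in> I \<longrightarrow> f t = \<infinity> then 0
      else \<infinity>)"

definition ennreal_sqrt :: "ennreal \<Rightarrow> ennreal" where
  "ennreal_sqrt x = (if x = \<infinity> then \<infinity> else ennreal (sqrt (enn2real x)))"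

text \<open>The value is \<open>\<infinity>\<close> when the supremum diverges. Only the oscillations enter, so functions
  outside \<open>L\<^sup>2(\<real>)\<close>, such as balayages of Carleson measures of infinite mass, are admitted.\<close>

definition BMOd_norm :: "(real \<Rightarrow> ennreal) \<Rightarrow> ennreal" where
  "BMOd_norm f = ennreal_sqrt (SUP I\<in>dyadic_intervals. ext_square_oscillation f I)"

end

theory Submission
  imports Defs
begin

text \<open>On a dyadic interval \<open>I\<close> the balayage is a constant plus the part \<open>F\<close> coming from the tops
  \<open>T\<^sub>J\<close> with \<open>J \<subseteq> I\<close>. Expanding the square over nested pairs of dyadic intervals bounds the integral
  of \<open>F\<^sup>2\<close> by \<open>2 Carl(\<mu>)\<^sup>2 |I|\<close>, which gives the upper estimate, for every restriction of \<open>\<mu>\<close> as well.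
  Conversely, the balayage of the restriction to \<open>Q\<^sub>I\<close> has integral \<open>\<mu>(Q\<^sub>I)\<close> and is supported on \<open>I\<close>, so
  its oscillation over the dyadic parent of \<open>I\<close> is at least a multiple of \<open>\<mu>(Q\<^sub>I) / |I|\<close>.\<close>

text \<open>Turns the unconditional sum defining the balayage into a nonnegative integral over a
  counting measure, so that linearity, monotonicity and Tonelli's theorem apply to it.\<close>

lemma infsum_eq_nn_integral_count_space:
  fixes f :: "'a \<Rightarrow> ennreal"
  assumes "countable A"
  shows "infsum f A = (\<integral>\<^sup>+x. f x \<partial>count_space A)"
proof (cases "finite A")
  case True
  then show ?thesis by (simp add: nn_integral_count_space_finite)
next
  case False
  note bij = bij_betw_from_nat_into[OF assms False]
  have "infsum f A = infsum (\<lambda>n. f (from_nat_into A n)) UNIV"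
    by (rule infsum_reindex_bij_betw[OF bij, symmetric])
  also have "\<dots> = (\<Sum>n. f (from_nat_into A n))"
    by (intro sums_unique has_sum_imp_sums has_sum_infsum nonneg_summable_on_complete) simp
  also have "\<dots> = (\<integral>\<^sup>+x. f x \<partial>count_space A)"
    by (subst nn_integral_bij_count_space[OF bij, symmetric]) (simp add: nn_integral_count_space_nat)
  finally show ?thesis .
qed

section \<open>Geometry of dyadic intervals\<close>

lemma dyadic_intervalE:
  assumes "I \<in> dyadic_intervals"
  obtains n k :: int where "I = {of_int k * 2 powi n <.. (of_int k + 1) * 2 powi n}" "len I = 2 powi n"
proof -
  obtain n k :: int where I: "I = {of_int k * 2 powi n <.. (of_int k + 1) * 2 powi n}"
    using assms unfolding dyadic_intervals_def by blast
  have "of_int k * (2::real) powi n \<le> (of_int k + 1) * 2 powi n"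
    by (simp add: algebra_simps)
  then have "len I = 2 powi n"
    unfolding I by (simp add: algebra_simps)
  with I that show ?thesis by blast
qed

lemma countable_dyadic_intervals: "countable dyadic_intervals"
proof -
  have *: "dyadic_intervals = range (\<lambda>(k::int, n::int). {of_int k * (2::real) powi n <.. (of_int k + 1) * 2 powi n})"
    unfolding dyadic_intervals_def by auto
  show ?thesis unfolding * by (intro countable_image countableI_type)
qed

lemma len_dyadic_pos: "I \<in> dyadic_intervals \<Longrightarrow> 0 < len I"
  by (elim dyadic_intervalE) simp

lemma dyadic_sets_borel: "I \<in> dyadic_intervals \<Longrightarrow> I \<in> sets borel"
  by (elim dyadic_intervalE) simp

lemma emeasure_dyadic: "I \<in> dyadic_intervals \<Longrightarrow> emeasure lborel I = ennreal (len I)"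
  by (elim dyadic_intervalE) (simp add: algebra_simps)

lemma dyadic_bounded_interval:
  assumes "I \<in> dyadic_intervals"
  shows "is_interval I" "bounded I"
  using assms by (auto elim!: dyadic_intervalE simp: is_interval_def)

lemma powi2_less_iff: "(2::real) powi m < 2 powi n \<longleftrightarrow> m < n"
  using power_int_strict_increasing[of m n "2::real"] power_int_increasing[of n m "2::real"] by fastforce

lemma powi2_le_iff: "(2::real) powi m \<le> 2 powi n \<longleftrightarrow> m \<le> n"
  by (meson linorder_not_less powi2_less_iff)

text \<open>All endpoints of both intervals are integer multiples of the smaller length
  \<open>d\<close>. A common point gives strict inequalities between these integers, and strictness
  gains a full unit, which is exactly the slack that containment requires.\<close>

lemma dyadic_nested:
  assumes "I \<in> dyadic_intervals" "J \<in> dyadic_intervals" "len J \<le> len I" "t \<in> I" "t \<in> J"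
  shows "J \<subseteq> I"
proof -
  obtain n k :: int where I: "I = {of_int k * 2 powi n <.. (of_int k + 1) * 2 powi n}" "len I = 2 powi n"
    using assms(1) by (rule dyadic_intervalE)
  obtain m j :: int where J: "J = {of_int j * 2 powi m <.. (of_int j + 1) * 2 powi m}" "len J = 2 powi m"
    using assms(2) by (rule dyadic_intervalE)
  have mn: "m \<le> n" using assms(3) unfolding I(2) J(2) powi2_le_iff .
  define N :: int where "N = 2 ^ nat (n - m)"
  define d :: real where "d = 2 powi m"
  have d: "0 < d" by (simp add: d_def)
  have "(2::real) powi n = 2 powi (n - m) * 2 powi m"
    by (simp flip: power_int_add)
  also have "(2::real) powi (n - m) = of_int N"
    using mn by (simp add: N_def power_int_def)
  finally have *: "(2::real) powi n = of_int N * d" by (simp add: d_def)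
  have I': "I = {of_int (k * N) * d <.. of_int ((k + 1) * N) * d}"
    unfolding I * by (simp add: mult.assoc)
  have J': "J = {of_int j * d <.. of_int (j + 1) * d}"
    unfolding J by (simp add: d_def)
  have "of_int j * d < of_int ((k + 1) * N) * d" "of_int (k * N) * d < of_int (j + 1) * d"
    using assms(4,5) unfolding I' J' by auto
  then have "j < (k + 1) * N" "k * N < j + 1"
    using d by (simp_all only: mult_less_cancel_right_pos of_int_less_iff)
  then have "j + 1 \<le> (k + 1) * N" "k * N \<le> j" by auto
  then have "of_int (j + 1) * d \<le> of_int ((k + 1) * N) * d" "of_int (k * N) * d \<le> of_int j * d"
    using d by (simp_all only: mult_le_cancel_right_pos of_int_le_iff)
  then show ?thesis unfolding I' J' by auto
qed

lemma dyadic_cases: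
  assumes "I \<in> dyadic_intervals" "J \<in> dyadic_intervals" "t \<in> I" "t \<in> J"
  shows "J \<subseteq> I \<or> I \<subseteq> J"
  using dyadic_nested assms by (meson linorder_le_cases)

lemma len_dyadic_mono:
  assumes "I \<in> dyadic_intervals" "J \<in> dyadic_intervals" "J \<subseteq> I"
  shows "len J \<le> len I"
proof -
  have "emeasure lborel J \<le> emeasure lborel I"
    using assms dyadic_sets_borel by (intro emeasure_mono) auto
  then show ?thesis using assms by (simp add: emeasure_dyadic)
qed

lemma dyadic_parent:
  assumes "I \<in> dyadic_intervals"
  obtains P where "P \<in> dyadic_intervals" "I \<subseteq> P" "len P = 2 * len I"
proof -
  obtain n k :: int where I: "I = {of_int k * 2 powi n <.. (of_int k + 1) * 2 powi n}" "len I = 2 powi n"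
    using assms by (rule dyadic_intervalE)
  define d :: real where "d = 2 powi n"
  have d: "0 < d" by (simp add: d_def)
  \<comment> \<open>Halving the index with \<open>div\<close> finds the parent whether
    \<open>I\<close> is its left or its right half.\<close>
  define P where "P = {of_int (k div 2) * (2::real) powi (n + 1) <.. (of_int (k div 2) + 1) * 2 powi (n + 1)}"
  have P: "P \<in> dyadic_intervals" unfolding P_def dyadic_intervals_def by blast
  have d2: "(2::real) powi (n + 1) = 2 * d" by (simp add: d_def power_int_add)
  have P': "P = {of_int (2 * (k div 2)) * d <.. of_int (2 * (k div 2) + 2) * d}"
    unfolding P_def d2 by (simp add: algebra_simps)
  have I': "I = {of_int k * d <.. of_int (k + 1) * d}"
    unfolding I by (simp add: d_def)
  have "2 * (k div 2) \<le> k" "k + 1 \<le> 2 * (k div 2) + 2" by auto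
  then have "of_int (2 * (k div 2)) * d \<le> of_int k * d" "of_int (k + 1) * d \<le> of_int (2 * (k div 2) + 2) * d"
    using d by (simp_all only: mult_le_cancel_right_pos of_int_le_iff)
  then have "I \<subseteq> P" unfolding I' P' by auto
  moreover have "len P = 2 * len I"
    unfolding P_def I(2) d2 using d by (simp add: algebra_simps d_def[symmetric])
  ultimately show ?thesis using that P by blast
qed

lemma dyadic_contains:
  obtains J where "J \<in> dyadic_intervals" "x \<in> J" "len J = 2 powi n"
proof -
  define d :: real where "d = 2 powi n"
  have d: "0 < d" by (simp add: d_def)
  \<comment> \<open>Ceiling minus one instead of floor, since the intervals omit their left endpoint
    and include the right one.\<close>
  define k where "k = \<lceil>x / d\<rceil> - 1"
  have "of_int k < x / d" "x / d \<le> of_int k + 1"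
    unfolding k_def by linarith+
  then have "x \<in> {of_int k * 2 powi n <.. (of_int k + 1) * 2 powi n}"
    using d by (simp add: d_def field_simps)
  moreover have "len {of_int k * 2 powi n <.. (of_int k + 1) * 2 powi n} = 2 powi n"
    by (simp add: algebra_simps)
  moreover have "{of_int k * 2 powi n <.. (of_int k + 1) * (2::real) powi n} \<in> dyadic_intervals"
    unfolding dyadic_intervals_def by blast
  ultimately show ?thesis using that by blast
qed

section \<open>Tiling of Carleson squares by top halves\<close>

lemma dyadic_scale:
  assumes "0 < (y::real)"
  obtains n :: int where "2 powi n / 2 < y" "y \<le> 2 powi n"
proof -
  define n where "n = \<lceil>log 2 y\<rceil>"
  have p: "(2::real) powi n = 2 powr of_int n" for n :: int
    by (simp add: powr_real_of_int')
  have "y = 2 powr (log 2 y)" using assms by simp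
  also have "\<dots> \<le> 2 powr of_int n" by (intro powr_mono) (auto simp: n_def)
  finally have "y \<le> 2 powi n" by (simp add: p)
  have "(2::real) powi n / 2 = 2 powr (of_int n - 1)" by (simp add: p powr_diff)
  also have "\<dots> < 2 powr (log 2 y)" by (intro powr_less_mono) (unfold n_def, linarith, simp)
  also have "\<dots> = y" using assms by simp
  finally show ?thesis using that \<open>y \<le> 2 powi n\<close> by blast
qed

text \<open>The height of a point fixes the length of the interval, and among dyadic intervals of
  one length the abscissa fixes the interval.\<close>

lemma top_half_disjoint:
  assumes "I \<in> dyadic_intervals" "J \<in> dyadic_intervals" "z \<in> top_half I" "z \<in> top_half J"
  shows "I = J"
proof -
  obtain x y where z: "z = (x, y)" by force
  obtain n k :: int where I: "I = {of_int k * 2 powi n <.. (of_int k + 1) * 2 powi n}" "len I = 2 powi n"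
    using assms(1) by (rule dyadic_intervalE)
  obtain m j :: int where J: "J = {of_int j * 2 powi m <.. (of_int j + 1) * 2 powi m}" "len J = 2 powi m"
    using assms(2) by (rule dyadic_intervalE)
  have h: "(2::real) powi i / 2 = 2 powi (i - 1)" for i by (simp add: power_int_diff)
  have "(2::real) powi (n - 1) < 2 powi m" "(2::real) powi (m - 1) < 2 powi n"
    using assms(3,4) unfolding top_half_def z I(2) J(2) h by auto
  then have "n = m" unfolding powi2_less_iff by simp
  then have "len I = len J" using I J by simp
  moreover have "x \<in> I" "x \<in> J" using assms(3,4) by (auto simp: z top_half_def)
  ultimately show ?thesis
    using dyadic_nested[OF assms(1,2)] dyadic_nested[OF assms(2,1)] by (metis order_refl subset_antisym)
qed

text \<open>The height \<open>y\<close> of a point selects a scale with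
  \<open>2 powi n / 2 < y \<le> 2 powi n\<close>. As \<open>y \<le> len I\<close> and lengths are
  powers of two, this scale does not exceed \<open>len I\<close>, so nesting puts the chosen
  interval inside \<open>I\<close>.\<close>

lemma carleson_square_eq_UN_top_half:
  assumes I: "I \<in> dyadic_intervals"
  shows "carleson_square I = (\<Union>J\<in>{J\<in>dyadic_intervals. J \<subseteq> I}. top_half J)"
proof (intro equalityI subsetI)
  fix z assume "z \<in> carleson_square I"
  then obtain x y where z: "z = (x, y)" and x: "x \<in> I" "0 < y" "y \<le> len I"
    by (auto simp: carleson_square_def)
  obtain n where n: "2 powi n / 2 < y" "y \<le> 2 powi n" using dyadic_scale[OF x(2)] .
  obtain J where J: "J \<in> dyadic_intervals" "x \<in> J" "len J = 2 powi n" by (rule dyadic_contains)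
  have "len J \<le> len I"
  proof -
    obtain m k :: int where "I = {of_int k * 2 powi m <.. (of_int k + 1) * 2 powi m}" and m: "len I = 2 powi m"
      using I by (rule dyadic_intervalE)
    have "(2::real) powi (n - 1) < 2 powi m" using n x m by (simp add: power_int_diff)
    then show ?thesis unfolding J m powi2_le_iff powi2_less_iff by simp
  qed
  then have "J \<subseteq> I" using dyadic_nested I J x by blast
  then show "z \<in> (\<Union>J\<in>{J\<in>dyadic_intervals. J \<subseteq> I}. top_half J)"
    using J n x by (auto simp: z top_half_def)
next
  fix z assume "z \<in> (\<Union>J\<in>{J\<in>dyadic_intervals. J \<subseteq> I}. top_half J)"
  then obtain J where J: "J \<in> dyadic_intervals" "J \<subseteq> I" "z \<in> top_half J" by blast
  then show "z \<in> carleson_square I"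
    using len_dyadic_mono[OF I J(1,2)] len_dyadic_pos[OF J(1)]
    by (auto simp: top_half_def carleson_square_def)
qed

lemma top_half_Int_carleson_square:
  assumes I: "I \<in> dyadic_intervals" and J: "J \<in> dyadic_intervals" and "\<not> J \<subseteq> I"
  shows "carleson_square I \<inter> top_half J = {}"
  using assms top_half_disjoint[OF J] by (auto simp: carleson_square_eq_UN_top_half)

lemma sets_borel_top_half: "I \<in> dyadic_intervals \<Longrightarrow> top_half I \<in> sets borel"
proof -
  assume "I \<in> dyadic_intervals"
  moreover have "top_half I = I \<times> {len I / 2 <.. len I}" by (auto simp: top_half_def)
  ultimately show ?thesis by (simp add: borel_prod[symmetric] dyadic_sets_borel)
qed

lemma sets_borel_carleson_square: "I \<in> dyadic_intervals \<Longrightarrow> carleson_square I \<in> sets borel"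
proof -
  assume "I \<in> dyadic_intervals"
  moreover have "carleson_square I = I \<times> {0 <.. len I}" by (auto simp: carleson_square_def)
  ultimately show ?thesis by (simp add: borel_prod[symmetric] dyadic_sets_borel)
qed

lemma sets_borel_upper_half_plane: "upper_half_plane \<in> sets borel"
proof -
  have "upper_half_plane = UNIV \<times> {0::real<..}" by (auto simp: upper_half_plane_def)
  also have "\<dots> \<in> sets borel" by (simp add: borel_prod[symmetric])
  finally show ?thesis .
qed

lemma carleson_square_subset_upper_half_plane: "carleson_square I \<subseteq> upper_half_plane"
  by (auto simp: carleson_square_def upper_half_plane_def)

lemma top_half_subset_upper_half_plane: "I \<in> dyadic_intervals \<Longrightarrow> top_half I \<subseteq> upper_half_plane"
  using len_dyadic_pos by (fastforce simp: top_half_def upper_half_plane_def)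

lemma carleson_measure_sets_iff:
  assumes "carleson_measure \<mu>"
  shows "A \<in> sets \<mu> \<longleftrightarrow> A \<in> sets borel \<and> A \<subseteq> upper_half_plane"
proof -
  have "sets \<mu> = sets (restrict_space borel upper_half_plane)"
    using assms by (simp add: carleson_measure_def regular_borel_measure_uhp_def)
  then show ?thesis
    by (simp add: sets_restrict_space_iff sets_borel_upper_half_plane conj_commute)
qed

text \<open>The balayage depends on the measure only through the masses \<open>a J = \<mu>(T\<^sub>J)\<close>.\<close>

definition dyadic_sum :: "(real set \<Rightarrow> ennreal) \<Rightarrow> real \<Rightarrow> ennreal" where
  "dyadic_sum a t = (\<integral>\<^sup>+J. indicator J t / ennreal (len J) * a J \<partial>count_space dyadic_intervals)"

text \<open>For a Carleson measure and \<open>a J\<close> the mass of the top half over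
  \<open>J\<close>, this is the mass of the Carleson square over a dyadic \<open>I\<close>; see
  \<open>emeasure_carleson_square\<close>.\<close>

definition mass_below :: "(real set \<Rightarrow> ennreal) \<Rightarrow> real set \<Rightarrow> ennreal" where
  "mass_below a I = (\<integral>\<^sup>+J. indicator (Pow I) J * a J \<partial>count_space dyadic_intervals)"

lemma dyadic_balayage_eq_dyadic_sum:
  "dyadic_balayage \<mu> = dyadic_sum (\<lambda>J. emeasure \<mu> (top_half J))"
  by (intro ext) (simp add: dyadic_balayage_def dyadic_sum_def
      infsum_eq_nn_integral_count_space countable_dyadic_intervals)

section \<open>Measurability, integral and square integral of dyadic sums\<close>

text \<open>With a countable discrete index set, measurability in \<open>x\<close> for each index
  already gives joint measurability, and the counting measure is sigma-finite.\<close>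

lemma borel_measurable_nn_integral_count_space:
  fixes f :: "'i \<Rightarrow> 'a \<Rightarrow> ennreal"
  assumes "countable A" and f: "\<And>i. i \<in> A \<Longrightarrow> f i \<in> borel_measurable M"
  shows "(\<lambda>x. \<integral>\<^sup>+i. f i x \<partial>count_space A) \<in> borel_measurable M"
proof -
  have "(\<lambda>(x, i). f i x) \<in> borel_measurable (M \<Otimes>\<^sub>M count_space A)"
    by (subst measurable_pair_swap_iff, rule measurable_pair_measure_countable1[OF assms(1)]) (use f in simp)
  then show ?thesis
    by (rule sigma_finite_measure.borel_measurable_nn_integral[OF sigma_finite_measure_count_space_countable[OF assms(1)]])
qed

lemma indicator_dyadic_measurable [measurable]:
  "J \<in> dyadic_intervals \<Longrightarrow> (\<lambda>t. indicator J t :: ennreal) \<in> borel_measurable borel"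
  using dyadic_sets_borel by simp

lemma borel_measurable_dyadic_sum [measurable]: "dyadic_sum a \<in> borel_measurable borel"
  unfolding dyadic_sum_def[abs_def]
  by (intro borel_measurable_nn_integral_count_space countable_dyadic_intervals) measurable

lemma len_dyadic_mult_divide:
  assumes "J \<in> dyadic_intervals"
  shows "ennreal (len J) * (x / ennreal (len J)) = x"
  using len_dyadic_pos[OF assms]
  by (simp add: ennreal_times_divide ennreal_mult_divide_eq mult.commute)

lemma nn_integral_dyadic_weight:
  assumes "J \<in> dyadic_intervals"
  shows "(\<integral>\<^sup>+t. indicator J t * x \<partial>lborel) = ennreal (len J) * x"
  using assms by (simp add: nn_integral_multc dyadic_sets_borel emeasure_dyadic)

lemma dyadic_sum_alt:
  "dyadic_sum a t = (\<integral>\<^sup>+J. indicator J t * (a J / ennreal (len J)) \<partial>count_space dyadic_intervals)"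
  unfolding dyadic_sum_def by (simp add: ennreal_times_divide divide_ennreal_def mult_ac)

text \<open>By Tonelli the sum is integrated term by term, and the weight \<open>1 / len J\<close>
  cancels the length of \<open>J\<close>.\<close>

lemma nn_integral_dyadic_sum:
  "(\<integral>\<^sup>+t. dyadic_sum a t \<partial>lborel) = (\<integral>\<^sup>+J. a J \<partial>count_space dyadic_intervals)"
proof -
  have "(\<integral>\<^sup>+t. dyadic_sum a t \<partial>lborel)
      = (\<integral>\<^sup>+J. \<integral>\<^sup>+t. indicator J t * (a J / ennreal (len J)) \<partial>lborel \<partial>count_space dyadic_intervals)"
    unfolding dyadic_sum_alt
    by (intro nn_integral_count_space_nn_integral countable_dyadic_intervals) measurable
  also have "\<dots> = (\<integral>\<^sup>+J. a J \<partial>count_space dyadic_intervals)"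
    by (intro nn_integral_cong) (simp add: nn_integral_dyadic_weight len_dyadic_mult_divide)
  finally show ?thesis .
qed

text \<open>Two dyadic intervals through a common point are nested, so the square of the sum is at most
  twice its part over nested pairs; integrating out the inner interval leaves \<open>mass_below\<close>.\<close>

lemma nn_integral_dyadic_sum_square_le:
  assumes K: "\<And>I. I \<in> dyadic_intervals \<Longrightarrow> mass_below a I \<le> K * ennreal (len I)"
  shows "(\<integral>\<^sup>+t. (dyadic_sum a t)\<^sup>2 \<partial>lborel) \<le> 2 * (K * (\<integral>\<^sup>+J. a J \<partial>count_space dyadic_intervals))"
proof -
  let ?D = "count_space dyadic_intervals"
  define w where "w J = a J / ennreal (len J)" for J
  \<comment> \<open>The term of the pair with outer interval \<open>J\<close> and inner interval
    \<open>L\<close>. No indicator of \<open>J\<close> at \<open>t\<close> appears, because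
    \<open>t \<in> L\<close> and \<open>L \<subseteq> J\<close> imply
    \<open>t \<in> J\<close>.\<close>
  define g :: "real set \<Rightarrow> real set \<Rightarrow> real \<Rightarrow> ennreal"
    where "g J L t = indicator L t * (indicator (Pow J) L * (w J * w L))" for J L t
  have g[measurable]: "\<And>J L. L \<in> dyadic_intervals \<Longrightarrow> g J L \<in> borel_measurable lborel"
    unfolding g_def[abs_def] by measurable
  have inner[measurable]: "(\<lambda>t. \<integral>\<^sup>+L. g J L t \<partial>?D) \<in> borel_measurable lborel" for J
    by (intro borel_measurable_nn_integral_count_space countable_dyadic_intervals g) simp_all
  have outer[measurable]: "(\<lambda>t. \<integral>\<^sup>+J. \<integral>\<^sup>+L. g J L t \<partial>?D \<partial>?D) \<in> borel_measurable lborel"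
    by (intro borel_measurable_nn_integral_count_space countable_dyadic_intervals g) simp_all
  have pointwise: "(dyadic_sum a t)\<^sup>2 \<le> 2 * (\<integral>\<^sup>+J. \<integral>\<^sup>+L. g J L t \<partial>?D \<partial>?D)" for t
  proof -
    have "(dyadic_sum a t)\<^sup>2 = (\<integral>\<^sup>+J. \<integral>\<^sup>+L. (indicator J t * w J) * (indicator L t * w L) \<partial>?D \<partial>?D)"
      by (simp add: power2_eq_square dyadic_sum_alt w_def nn_integral_cmult nn_integral_multc)
    \<comment> \<open>A product is nonzero only if both intervals contain \<open>t\<close>, hence
      only for nested pairs. The diagonal is counted twice on the right, which an upper bound
      permits.\<close>
    also have "\<dots> \<le> (\<integral>\<^sup>+J. \<integral>\<^sup>+L. g J L t + g L J t \<partial>?D \<partial>?D)"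
    proof (intro nn_integral_mono)
      fix J L assume "J \<in> space ?D" "L \<in> space ?D"
      then have "t \<in> J \<Longrightarrow> t \<in> L \<Longrightarrow> J \<subseteq> L \<or> L \<subseteq> J"
        using dyadic_cases by auto
      then show "(indicator J t * w J) * (indicator L t * w L) \<le> g J L t + g L J t"
        by (auto simp: g_def indicator_def mult_ac)
    qed
    also have "\<dots> = (\<integral>\<^sup>+J. \<integral>\<^sup>+L. g J L t \<partial>?D \<partial>?D) + (\<integral>\<^sup>+J. \<integral>\<^sup>+L. g L J t \<partial>?D \<partial>?D)"
      by (simp add: nn_integral_add)
    \<comment> \<open>Interchanging the two summations shows that both orders of nesting contribute
      equally; this is the factor 2.\<close>
    also have "(\<integral>\<^sup>+J. \<integral>\<^sup>+L. g L J t \<partial>?D \<partial>?D) = (\<integral>\<^sup>+J. \<integral>\<^sup>+L. g J L t \<partial>?D \<partial>?D)"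
      by (intro nn_integral_count_space_nn_integral countable_dyadic_intervals) simp
    finally show ?thesis by (simp add: mult_2)
  qed
  have "(\<integral>\<^sup>+t. (dyadic_sum a t)\<^sup>2 \<partial>lborel) \<le> (\<integral>\<^sup>+t. 2 * (\<integral>\<^sup>+J. \<integral>\<^sup>+L. g J L t \<partial>?D \<partial>?D) \<partial>lborel)"
    by (intro nn_integral_mono pointwise)
  also have "\<dots> = 2 * (\<integral>\<^sup>+t. (\<integral>\<^sup>+J. \<integral>\<^sup>+L. g J L t \<partial>?D \<partial>?D) \<partial>lborel)"
    by (intro nn_integral_cmult outer)
  also have "(\<integral>\<^sup>+t. (\<integral>\<^sup>+J. \<integral>\<^sup>+L. g J L t \<partial>?D \<partial>?D) \<partial>lborel)
      = (\<integral>\<^sup>+J. \<integral>\<^sup>+t. \<integral>\<^sup>+L. g J L t \<partial>?D \<partial>lborel \<partial>?D)"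
    by (intro nn_integral_count_space_nn_integral countable_dyadic_intervals inner)
  also have "\<dots> = (\<integral>\<^sup>+J. \<integral>\<^sup>+L. \<integral>\<^sup>+t. g J L t \<partial>lborel \<partial>?D \<partial>?D)"
    by (intro nn_integral_cong nn_integral_count_space_nn_integral countable_dyadic_intervals g) simp_all
  also have "\<dots> \<le> (\<integral>\<^sup>+J. K * a J \<partial>?D)"
  proof (intro nn_integral_mono)
    fix J assume "J \<in> space ?D"
    then have J: "J \<in> dyadic_intervals" by simp
    \<comment> \<open>For fixed \<open>J\<close>, integrating over the inner interval turns
      \<open>w L\<close> back into \<open>a L\<close>, so the inner sum becomes a multiple of
      \<open>mass_below a J\<close>, to which the hypothesis applies.\<close>
    have "(\<integral>\<^sup>+L. \<integral>\<^sup>+t. g J L t \<partial>lborel \<partial>?D) = (\<integral>\<^sup>+L. w J * (indicator (Pow J) L * a L) \<partial>?D)"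
    proof (intro nn_integral_cong)
      fix L assume "L \<in> space ?D"
      then have L: "L \<in> dyadic_intervals" by simp
      have "(\<integral>\<^sup>+t. g J L t \<partial>lborel) = w J * (indicator (Pow J) L * (ennreal (len L) * w L))"
        unfolding g_def nn_integral_dyadic_weight[OF L] by (simp only: mult_ac)
      then show "(\<integral>\<^sup>+t. g J L t \<partial>lborel) = w J * (indicator (Pow J) L * a L)"
        by (simp add: w_def len_dyadic_mult_divide[OF L])
    qed
    also have "\<dots> = w J * mass_below a J"
      by (simp add: mass_below_def nn_integral_cmult)
    also have "\<dots> \<le> w J * (K * ennreal (len J))"
      by (intro mult_left_mono K J) simp
    also have "\<dots> = K * (ennreal (len J) * w J)" by (simp add: mult_ac)
    also have "\<dots> = K * a J" by (simp add: w_def len_dyadic_mult_divide[OF J])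
    finally show "(\<integral>\<^sup>+L. \<integral>\<^sup>+t. g J L t \<partial>lborel \<partial>?D) \<le> K * a J" .
  qed
  also have "\<dots> = K * (\<integral>\<^sup>+J. a J \<partial>?D)"
    by (simp add: nn_integral_cmult)
  finally show ?thesis by (simp add: mult_left_mono)
qed

section \<open>Upper and lower bounds for the oscillation of dyadic sums\<close>

text \<open>A dyadic interval through a point of \<open>I\<close> either lies inside
  \<open>I\<close> or strictly contains it. Intervals of the second kind cover all of
  \<open>I\<close>, so their contribution, possibly infinite, is the same at every point of
  \<open>I\<close>.\<close>

lemma dyadic_sum_split:
  assumes I: "I \<in> dyadic_intervals"
  obtains c where "\<And>t. t \<in> I \<Longrightarrow> dyadic_sum a t = c + dyadic_sum (\<lambda>J. indicator (Pow I) J * a J) t"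
proof
  let ?D = "count_space dyadic_intervals"
  fix t assume t: "t \<in> I"
  let ?c = "\<integral>\<^sup>+J. (if I \<subset> J then a J / ennreal (len J) else 0) \<partial>?D"
  have "dyadic_sum a t = (\<integral>\<^sup>+J. (if I \<subset> J then a J / ennreal (len J) else 0)
      + indicator J t * (indicator (Pow I) J * a J / ennreal (len J)) \<partial>?D)"
    unfolding dyadic_sum_alt
  proof (intro nn_integral_cong)
    fix J assume "J \<in> space ?D"
    then have "t \<in> J \<Longrightarrow> J \<subseteq> I \<or> I \<subseteq> J" using dyadic_cases[OF I _ t] by simp
    then show "indicator J t * (a J / ennreal (len J)) = (if I \<subset> J then a J / ennreal (len J) else 0)
      + indicator J t * (indicator (Pow I) J * a J / ennreal (len J))"
      using t by (auto simp: indicator_def)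
  qed
  then show "dyadic_sum a t = ?c + dyadic_sum (\<lambda>J. indicator (Pow I) J * a J) t"
    unfolding dyadic_sum_alt by (simp add: nn_integral_add)
qed

lemma ennreal_sqrt_mono: "x \<le> y \<Longrightarrow> ennreal_sqrt x \<le> ennreal_sqrt y"
  by (auto simp: ennreal_sqrt_def top_unique less_top[symmetric] intro!: ennreal_leI enn2real_mono)

lemma ennreal_sqrt_power2: "0 \<le> r \<Longrightarrow> ennreal_sqrt (ennreal (r\<^sup>2)) = ennreal r"
  by (simp add: ennreal_sqrt_def)

text \<open>The constant from \<open>dyadic_sum_split\<close>, when finite, drops out of the
  oscillation. The remaining part has mean at most \<open>K\<close> over \<open>I\<close> and square
  integral at most \<open>2 * K\<^sup>2 * len I\<close>, so the square oscillation is at most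
  \<open>3 * K\<^sup>2\<close>.\<close>

lemma ext_square_oscillation_dyadic_sum_le:
  assumes I: "I \<in> dyadic_intervals" and "0 \<le> K"
    and K: "\<And>J. J \<in> dyadic_intervals \<Longrightarrow> mass_below a J \<le> ennreal (K * len J)"
  shows "ext_square_oscillation (dyadic_sum a) I \<le> ennreal ((2 * K)\<^sup>2)"
proof -
  define b where "b = (\<lambda>J. indicator (Pow I) J * a J)"
  obtain c where c: "\<And>t. t \<in> I \<Longrightarrow> dyadic_sum a t = c + dyadic_sum b t"
    using dyadic_sum_split[OF I] unfolding b_def by blast
  have [measurable]: "I \<in> sets borel" using I by (rule dyadic_sets_borel)
  have l: "0 < len I" using I by (rule len_dyadic_pos)
  have emI: "emeasure lborel I = ennreal (len I)" using I by (rule emeasure_dyadic)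
  have int_F: "(\<integral>\<^sup>+t. dyadic_sum b t \<partial>lborel) \<le> ennreal (K * len I)"
    using K[OF I] by (simp add: nn_integral_dyadic_sum b_def mass_below_def)
  have int_F2: "(\<integral>\<^sup>+t. (dyadic_sum b t)\<^sup>2 \<partial>lborel) \<le> ennreal (2 * K\<^sup>2 * len I)"
  proof -
    \<comment> \<open>Discarding the coefficients outside \<open>I\<close> only decreases
      \<open>mass_below\<close>, so the same \<open>K\<close> serves for \<open>b\<close>.\<close>
    have "mass_below b J \<le> ennreal K * ennreal (len J)" if "J \<in> dyadic_intervals" for J
    proof -
      have "mass_below b J \<le> mass_below a J"
        unfolding mass_below_def b_def
        by (intro nn_integral_mono) (auto simp: indicator_def)
      then show ?thesis using K[OF that] \<open>0 \<le> K\<close> by (simp add: ennreal_mult)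
    qed
    from nn_integral_dyadic_sum_square_le[OF this]
    have "(\<integral>\<^sup>+t. (dyadic_sum b t)\<^sup>2 \<partial>lborel) \<le> 2 * (ennreal K * (\<integral>\<^sup>+t. dyadic_sum b t \<partial>lborel))"
      by (simp add: nn_integral_dyadic_sum)
    also have "\<dots> \<le> ennreal 2 * (ennreal K * ennreal (K * len I))"
      using int_F by (simp add: mult_left_mono)
    also have "\<dots> = ennreal (2 * K\<^sup>2 * len I)"
      using \<open>0 \<le> K\<close> by (simp add: ennreal_mult power2_eq_square mult_ac)
    finally show ?thesis .
  qed
  show ?thesis
  proof (cases "c = \<infinity>")
    case True
    \<comment> \<open>Infinite mass density from the larger intervals makes the sum identically
      infinite on \<open>I\<close>. As \<open>I\<close> has positive length, the finite branch of
      the definition is excluded and the oscillation is 0 by convention.\<close>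
    then have inf: "AE t in lborel. t \<in> I \<longrightarrow> dyadic_sum a t = \<infinity>"
      using c by simp
    moreover have "\<not> (AE t in lborel. t \<in> I \<longrightarrow> dyadic_sum a t < \<infinity>)"
    proof
      assume "AE t in lborel. t \<in> I \<longrightarrow> dyadic_sum a t < \<infinity>"
      with inf have "AE t in lborel. t \<notin> I" by eventually_elim auto
      then have "emeasure lborel I = 0" 
        using AE_iff_measurable[of I lborel "\<lambda>t. t \<notin> I"] by simp
      then show False using l by (simp add: emI)
    qed
    ultimately show ?thesis by (simp add: ext_square_oscillation_def)
  next
    case False
    then obtain cr where cr: "0 \<le> cr" "c = ennreal cr" by (cases c) auto
    have fin: "AE t in lborel. dyadic_sum b t \<noteq> \<infinity>"
      using int_F by (intro nn_integral_PInf_AE) (auto simp: top_unique)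
    have fin_a: "AE t in lborel. t \<in> I \<longrightarrow> dyadic_sum a t < \<infinity>"
      using fin by eventually_elim (auto simp: c cr less_top)
    define f where "f t = enn2real (dyadic_sum a t)" for t
    define h where "h t = enn2real (dyadic_sum b t)" for t
    have [measurable]: "f \<in> borel_measurable borel" "h \<in> borel_measurable borel"
      unfolding f_def[abs_def] h_def[abs_def] by measurable
    have h: "AE t in lborel. dyadic_sum b t = ennreal (h t)"
      using fin by eventually_elim (auto simp: h_def less_top)
    have h0: "0 \<le> h t" for t by (simp add: h_def)
    have fh: "AE t in lborel. t \<in> I \<longrightarrow> f t = cr + h t"
      using fin by eventually_elim (auto simp: f_def h_def c cr less_top enn2real_plus)
    have nn_h: "(\<integral>\<^sup>+t. ennreal (h t) \<partial>lborel) \<le> ennreal (K * len I)"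
      using int_F h by (subst nn_integral_cong_AE[of _ "dyadic_sum b"]) auto
    have int_h: "integrable lborel h"
      using nn_h h0 by (intro integrableI_bounded) (auto simp: top_unique less_top[symmetric] intro: le_less_trans)
    then have sint_h: "set_integrable lborel I h"
      unfolding set_integrable_def by (intro integrable_mult_indicator) auto
    define M where "M = (LINT t:I|lborel. h t) / len I"
    have "0 \<le> (LINT t:I|lborel. h t)"
      unfolding set_lebesgue_integral_def
      by (intro Bochner_Integration.integral_nonneg) (simp add: h0)
    then have M0: "0 \<le> M" using l by (simp add: M_def)
    have "(LINT t:I|lborel. h t) \<le> (LINT t|lborel. h t)"
      unfolding set_lebesgue_integral_def using sint_h int_h h0
      by (intro integral_mono) (auto simp: set_integrable_def indicator_def)
    also have "ennreal (LINT t|lborel. h t) \<le> ennreal (K * len I)"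
      using nn_h int_h h0 by (simp add: nn_integral_eq_integral)
    then have "(LINT t|lborel. h t) \<le> K * len I"
      using \<open>0 \<le> K\<close> l by (subst (asm) ennreal_le_iff) auto
    finally have MK: "M \<le> K" using l by (simp add: M_def pos_divide_le_eq)
    have mean: "mean f I = cr + M"
    proof -
      have "(LINT t:I|lborel. f t) = (LINT t:I|lborel. cr + h t)"
        using fh by (intro set_lebesgue_integral_cong_AE) auto
      also have "\<dots> = (LINT t:I|lborel. cr) + (LINT t:I|lborel. h t)"
        using sint_h emI by (intro set_integral_add) (auto simp: set_integrable_def)
      also have "(LINT t:I|lborel. cr) = cr * len I"
        by (simp add: set_lebesgue_integral_def)
      finally show ?thesis using l by (simp add: mean_def M_def field_simps)
    qed
    have pointwise: "AE t in lborel. ennreal (\<bar>f t - mean f I\<bar>\<^sup>2) * indicator I t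
        \<le> (dyadic_sum b t)\<^sup>2 + ennreal (K\<^sup>2) * indicator I t"
      using fh h
    proof eventually_elim
      case (elim t)
      have "(h t - M)\<^sup>2 \<le> (h t)\<^sup>2 + M\<^sup>2"
        using h0[of t] M0 by (simp add: power2_diff)
      also have "\<dots> \<le> (h t)\<^sup>2 + K\<^sup>2" using M0 MK by (simp add: power_mono)
      finally have "ennreal ((h t - M)\<^sup>2) \<le> (ennreal (h t))\<^sup>2 + ennreal (K\<^sup>2)"
        using h0 by (simp add: ennreal_power flip: ennreal_plus)
      then show ?case using elim mean by (auto simp: indicator_def)
    qed
    have "(\<integral>\<^sup>+t\<in>I. ennreal (\<bar>f t - mean f I\<bar>\<^sup>2) \<partial>lborel)
        \<le> (\<integral>\<^sup>+t. (dyadic_sum b t)\<^sup>2 + ennreal (K\<^sup>2) * indicator I t \<partial>lborel)"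
      using pointwise by (rule nn_integral_mono_AE)
    also have "\<dots> = (\<integral>\<^sup>+t. (dyadic_sum b t)\<^sup>2 \<partial>lborel) + ennreal (K\<^sup>2) * ennreal (len I)"
      by (simp add: nn_integral_add nn_integral_cmult emI)
    also have "\<dots> \<le> ennreal (2 * K\<^sup>2 * len I) + ennreal (K\<^sup>2) * ennreal (len I)"
      by (intro add_right_mono int_F2)
    also have "\<dots> = ennreal (3 * K\<^sup>2 * len I)"
      using l by (simp add: ennreal_mult[symmetric] ennreal_plus[symmetric] del: ennreal_plus)
    \<comment> \<open>Rounding 3 up to 4 makes the bound a perfect square, whose root is
      \<open>2 * K\<close>.\<close>
    also have "\<dots> \<le> ennreal ((2 * K)\<^sup>2 * len I)"
      using l by (intro ennreal_leI mult_right_mono) auto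
    finally have "square_oscillation f I \<le> ennreal ((2 * K)\<^sup>2 * len I) / ennreal (len I)"
      unfolding square_oscillation_def by (rule divide_right_mono_ennreal)
    also have "\<dots> = ennreal ((2 * K)\<^sup>2)"
      using l by (subst divide_ennreal) auto
    finally show ?thesis
      using fin_a by (simp add: ext_square_oscillation_def f_def[abs_def])
  qed
qed

lemma BMOd_norm_dyadic_sum_le:
  assumes "0 \<le> K"
    and "\<And>J. J \<in> dyadic_intervals \<Longrightarrow> mass_below a J \<le> ennreal (K * len J)"
  shows "BMOd_norm (dyadic_sum a) \<le> ennreal (2 * K)"
proof -
  have "BMOd_norm (dyadic_sum a) \<le> ennreal_sqrt (ennreal ((2 * K)\<^sup>2))"
    unfolding BMOd_norm_def
    by (intro ennreal_sqrt_mono SUP_least ext_square_oscillation_dyadic_sum_le assms)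
  also have "\<dots> = ennreal (2 * K)"
    using \<open>0 \<le> K\<close> by (intro ennreal_sqrt_power2) simp
  finally show ?thesis .
qed

text \<open>The sum vanishes on the sibling of \<open>I\<close>, while its mean over the parent of \<open>I\<close> is
  \<open>m / (2 * len I)\<close>; hence the square oscillation over the parent is at least
  \<open>m\<^sup>2 / (8 * (len I)\<^sup>2)\<close>.\<close>

lemma BMOd_norm_dyadic_sum_ge:
  assumes I: "I \<in> dyadic_intervals"
    and a: "\<And>J. J \<in> dyadic_intervals \<Longrightarrow> \<not> J \<subseteq> I \<Longrightarrow> a J = 0"
    and m: "(\<integral>\<^sup>+J. a J \<partial>count_space dyadic_intervals) = ennreal m" and "0 \<le> m"
  shows "ennreal (m / (3 * len I)) \<le> BMOd_norm (dyadic_sum a)"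
proof -
  obtain P where P: "P \<in> dyadic_intervals" and IP: "I \<subseteq> P" and lP: "len P = 2 * len I"
    using I by (rule dyadic_parent)
  have [measurable]: "I \<in> sets borel" "P \<in> sets borel"
    using I P by (auto intro: dyadic_sets_borel)
  have l: "0 < len I" using I by (rule len_dyadic_pos)
  have zero: "dyadic_sum a t = 0" if "t \<notin> I" for t
  proof -
    have "indicator J t / ennreal (len J) * a J = 0" if "J \<in> dyadic_intervals" for J
      using a[OF that] \<open>t \<notin> I\<close> by (cases "J \<subseteq> I") (auto simp: indicator_def)
    then have "dyadic_sum a t = (\<integral>\<^sup>+J. 0 \<partial>count_space dyadic_intervals)"
      unfolding dyadic_sum_def by (intro nn_integral_cong) simp
    then show ?thesis by simp
  qed
  have int_F: "(\<integral>\<^sup>+t. dyadic_sum a t \<partial>lborel) = ennreal m"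
    by (simp add: nn_integral_dyadic_sum m)
  have fin: "AE t in lborel. dyadic_sum a t \<noteq> \<infinity>"
    using int_F by (intro nn_integral_PInf_AE) auto
  then have fin_P: "AE t in lborel. t \<in> P \<longrightarrow> dyadic_sum a t < \<infinity>"
    by eventually_elim (simp add: less_top)
  define f where "f t = enn2real (dyadic_sum a t)" for t
  have [measurable]: "f \<in> borel_measurable borel" unfolding f_def[abs_def] by measurable
  \<comment> \<open>Since \<open>I \<subseteq> P\<close>, the integral over \<open>P\<close>
    captures the whole integral \<open>m\<close>.\<close>
  have "f t = 0" if "t \<notin> P" for t
    using zero[of t] subsetD[OF IP] that by (metis f_def enn2real_0)
  then have "(LINT t:P|lborel. f t) = (LINT t|lborel. f t)"
    unfolding set_lebesgue_integral_def
    by (intro Bochner_Integration.integral_cong) (auto simp: indicator_def)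
  also have "\<dots> = enn2real (\<integral>\<^sup>+t. dyadic_sum a t \<partial>lborel)"
    using fin by (intro enn2real_nn_integral_eq_integral[symmetric]) (auto simp: f_def less_top)
  also have "\<dots> = m" using int_F \<open>0 \<le> m\<close> by simp
  finally have mean: "mean f P = m / (2 * len I)" by (simp add: mean_def lP)
  have "emeasure lborel (P - I) = ennreal (len P) - ennreal (len I)"
    using IP I P by (subst emeasure_Diff) (auto simp: emeasure_dyadic)
  also have "\<dots> = ennreal (len I)" using l by (simp add: lP ennreal_minus)
  finally have PI: "emeasure lborel (P - I) = ennreal (len I)" .
  \<comment> \<open>Only the sibling \<open>P - I\<close> is kept: \<open>f\<close> vanishes there,
    so its deviation is exactly the mean.\<close>
  have "ennreal ((m / (2 * len I))\<^sup>2) * ennreal (len I)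
      = (\<integral>\<^sup>+t. ennreal ((m / (2 * len I))\<^sup>2) * indicator (P - I) t \<partial>lborel)"
    by (simp add: nn_integral_cmult PI)
  also have "\<dots> \<le> (\<integral>\<^sup>+t\<in>P. ennreal (\<bar>f t - mean f P\<bar>\<^sup>2) \<partial>lborel)"
    by (intro nn_integral_mono) (auto simp: indicator_def mean f_def zero)
  finally have "ennreal ((m / (2 * len I))\<^sup>2) * ennreal (len I) / ennreal (len P) \<le> square_oscillation f P"
    unfolding square_oscillation_def by (rule divide_right_mono_ennreal)
  also have "ennreal ((m / (2 * len I))\<^sup>2) * ennreal (len I) / ennreal (len P)
      = ennreal ((m / (2 * len I))\<^sup>2 / 2)"
    using l by (simp add: lP ennreal_mult[symmetric] divide_ennreal)
  also have "square_oscillation f P = ext_square_oscillation (dyadic_sum a) P"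
    using fin_P by (simp add: ext_square_oscillation_def f_def[abs_def])
  also have "\<dots> \<le> (SUP J\<in>dyadic_intervals. ext_square_oscillation (dyadic_sum a) J)"
    using P by (rule SUP_upper)
  finally have "ennreal ((m / (2 * len I))\<^sup>2 / 2) \<le> (SUP J\<in>dyadic_intervals. ext_square_oscillation (dyadic_sum a) J)" .
  \<comment> \<open>Because 8 is at most 9, the factor 3 can replace the square root of 8.\<close>
  moreover have "(m / (3 * len I))\<^sup>2 \<le> (m / (2 * len I))\<^sup>2 / 2"
    using l by (simp add: power_divide power_mult_distrib divide_simps)
  ultimately have "ennreal ((m / (3 * len I))\<^sup>2) \<le> (SUP J\<in>dyadic_intervals. ext_square_oscillation (dyadic_sum a) J)"
    by (meson ennreal_leI order_trans)
  then have "ennreal_sqrt (ennreal ((m / (3 * len I))\<^sup>2)) \<le> BMOd_norm (dyadic_sum a)"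
    unfolding BMOd_norm_def by (rule ennreal_sqrt_mono)
  then show ?thesis using l \<open>0 \<le> m\<close> by (simp add: ennreal_sqrt_power2)
qed

section \<open>From dyadic sums to Carleson measures\<close>

text \<open>Countable additivity over the disjoint tiling by top halves; it turns the Carleson
  condition into a bound on \<open>mass_below\<close>.\<close>

lemma emeasure_carleson_square:
  assumes \<mu>: "carleson_measure \<mu>" and I: "I \<in> dyadic_intervals"
  shows "emeasure \<mu> (carleson_square I) = mass_below (\<lambda>J. emeasure \<mu> (top_half J)) I"
proof -
  let ?S = "{J \<in> dyadic_intervals. J \<subseteq> I}"
  have "emeasure \<mu> (carleson_square I) = (\<integral>\<^sup>+J. emeasure \<mu> (top_half J) \<partial>count_space ?S)"
    unfolding carleson_square_eq_UN_top_half[OF I]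
  proof (rule emeasure_UN_countable)
    show "countable ?S"
      by (rule countable_subset[OF _ countable_dyadic_intervals]) auto
    show "disjoint_family_on top_half ?S"
      using top_half_disjoint by (fastforce simp: disjoint_family_on_def)
  qed (simp add: carleson_measure_sets_iff[OF \<mu>] sets_borel_top_half top_half_subset_upper_half_plane)
  also have "\<dots> = mass_below (\<lambda>J. emeasure \<mu> (top_half J)) I"
    unfolding mass_below_def
    by (subst (1 2) nn_integral_count_space_indicator)
      (auto intro!: nn_integral_cong simp: indicator_def)
  finally show ?thesis .
qed

text \<open>Restriction only decreases the masses of the top halves, so each constant admissible for
  \<mu> also bounds \<open>mass_below\<close> for the restricted measure.\<close>

lemma BMOd_norm_restrict_measure_le_Carl:
  assumes \<mu>: "carleson_measure \<mu>" and E: "E \<in> sets borel" "E \<subseteq> upper_half_plane"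
  shows "BMOd_norm (dyadic_balayage (restrict_measure \<mu> E)) \<le> 2 * Carl \<mu>"
proof -
  let ?B = "BMOd_norm (dyadic_balayage (restrict_measure \<mu> E))"
  \<comment> \<open>Halving the norm lets each admissible constant be compared directly with it
    under the infimum; the factor is restored at the end.\<close>
  have "?B / 2 \<le> Carl \<mu>"
    unfolding Carl_def
  proof (rule INF_greatest, clarify)
    fix K :: real assume "0 < K"
      and K: "\<forall>I\<in>dyadic_intervals. emeasure \<mu> (carleson_square I) \<le> ennreal (K * len I)"
    have "mass_below (\<lambda>J. emeasure (restrict_measure \<mu> E) (top_half J)) I \<le> ennreal (K * len I)"
      if I: "I \<in> dyadic_intervals" for I
    proof -
      have "mass_below (\<lambda>J. emeasure (restrict_measure \<mu> E) (top_half J)) I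
          \<le> mass_below (\<lambda>J. emeasure \<mu> (top_half J)) I"
        unfolding mass_below_def
      proof (intro nn_integral_mono mult_left_mono)
        fix J assume "J \<in> space (count_space dyadic_intervals)"
        then have "top_half J \<in> sets \<mu>"
          by (simp add: carleson_measure_sets_iff[OF \<mu>] sets_borel_top_half top_half_subset_upper_half_plane)
        moreover have "E \<in> sets \<mu>" using E by (simp add: carleson_measure_sets_iff[OF \<mu>])
        ultimately show "emeasure (restrict_measure \<mu> E) (top_half J) \<le> emeasure \<mu> (top_half J)"
          by (simp add: emeasure_restrict_measure emeasure_mono)
      qed simp
      also have "\<dots> \<le> ennreal (K * len I)"
        using K I by (simp add: emeasure_carleson_square[OF \<mu>])
      finally show ?thesis .
    qed
    then have "?B \<le> ennreal (2 * K)"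
      unfolding dyadic_balayage_eq_dyadic_sum using \<open>0 < K\<close> by (intro BMOd_norm_dyadic_sum_le) auto
    then have "?B / 2 \<le> ennreal (2 * K) / 2" by (rule divide_right_mono_ennreal)
    also have "\<dots> = ennreal K" using \<open>0 < K\<close> by (simp add: ennreal_mult ennreal_mult_divide_eq mult.commute)
    finally show "?B / 2 \<le> ennreal K" .
  qed
  then have "2 * (?B / 2) \<le> 2 * Carl \<mu>" by (rule mult_left_mono) simp
  moreover have "2 * (?B / 2) = ?B"
    unfolding ennreal_times_divide mult.commute[of 2] by (rule ennreal_mult_divide_eq) auto
  ultimately show ?thesis by simp
qed

text \<open>Restricting to the square keeps the top halves below \<open>I\<close> intact and
  annihilates all others. The coefficients thus sum to the mass of the square and the lower bound
  for dyadic sums applies.\<close>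

lemma emeasure_carleson_square_le_BMOd_norm:
  assumes \<mu>: "carleson_measure \<mu>" and I: "I \<in> dyadic_intervals"
  shows "emeasure \<mu> (carleson_square I)
    \<le> ennreal (3 * len I) * BMOd_norm (dyadic_balayage (restrict_measure \<mu> (carleson_square I)))"
proof -
  define a where "a J = emeasure (restrict_measure \<mu> (carleson_square I)) (top_half J)" for J
  have l: "0 < len I" using I by (rule len_dyadic_pos)
  have Q: "carleson_square I \<in> sets \<mu>"
    using I by (simp add: carleson_measure_sets_iff[OF \<mu>] sets_borel_carleson_square
        carleson_square_subset_upper_half_plane)
  have a_eq: "a J = indicator (Pow I) J * emeasure \<mu> (top_half J)" if J: "J \<in> dyadic_intervals" for J
  proof -
    have "top_half J \<in> sets \<mu>"
      using J by (simp add: carleson_measure_sets_iff[OF \<mu>] sets_borel_top_half top_half_subset_upper_half_plane)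
    with Q have "a J = emeasure \<mu> (carleson_square I \<inter> top_half J)"
      by (simp add: a_def emeasure_restrict_measure)
    moreover have "carleson_square I \<inter> top_half J = top_half J" if "J \<subseteq> I"
      using that J I by (auto simp: carleson_square_eq_UN_top_half)
    ultimately show ?thesis
      using top_half_Int_carleson_square[OF I J] by (cases "J \<subseteq> I") auto
  qed
  have sum_a: "(\<integral>\<^sup>+J. a J \<partial>count_space dyadic_intervals) = emeasure \<mu> (carleson_square I)"
    unfolding emeasure_carleson_square[OF \<mu> I] mass_below_def
    by (intro nn_integral_cong) (simp add: a_eq)
  \<comment> \<open>The Carleson condition enters to make this mass finite, hence a real number
    \<open>m\<close>.\<close>
  obtain C where "emeasure \<mu> (carleson_square I) \<le> ennreal (C * len I)"
    using \<mu> dyadic_bounded_interval[OF I] unfolding carleson_measure_def by blast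
  then obtain m where m: "0 \<le> m" "emeasure \<mu> (carleson_square I) = ennreal m"
    by (cases "emeasure \<mu> (carleson_square I)") (auto simp: top_unique)
  have "ennreal (m / (3 * len I)) \<le> BMOd_norm (dyadic_sum a)"
    using I m sum_a by (intro BMOd_norm_dyadic_sum_ge) (auto simp: a_eq)
  then have "ennreal (3 * len I) * ennreal (m / (3 * len I)) \<le> ennreal (3 * len I) * BMOd_norm (dyadic_sum a)"
    by (rule mult_left_mono) simp
  moreover have "ennreal (3 * len I) * ennreal (m / (3 * len I)) = ennreal m"
    using l m by (subst ennreal_mult[symmetric]) auto
  ultimately show ?thesis
    by (simp add: m a_def[abs_def] dyadic_balayage_eq_dyadic_sum)
qed

text \<open>The bounds on the individual squares make \<open>3 * S\<close> the candidate constant.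
  The extra \<open>e\<close> keeps it positive even when \<open>S\<close> is zero, as the infimum in
  \<open>Carl\<close> ranges over positive constants.\<close>

lemma Carl_le_of_BMOd_norm_le:
  assumes \<mu>: "carleson_measure \<mu>"
    and S: "\<And>I. I \<in> dyadic_intervals \<Longrightarrow>
      BMOd_norm (dyadic_balayage (restrict_measure \<mu> (carleson_square I))) \<le> S"
  shows "Carl \<mu> \<le> 3 * S"
proof (rule ennreal_le_epsilon)
  fix e :: real assume "3 * S < top" and e: "0 < e"
  then obtain s where s: "0 \<le> s" "S = ennreal s" by (cases S) (auto simp: ennreal_mult_top)
  have "emeasure \<mu> (carleson_square I) \<le> ennreal ((3 * s + e) * len I)" if I: "I \<in> dyadic_intervals" for I
  proof -
    have l: "0 < len I" using I by (rule len_dyadic_pos)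
    have "emeasure \<mu> (carleson_square I) \<le> ennreal (3 * len I) * ennreal s"
      using emeasure_carleson_square_le_BMOd_norm[OF \<mu> I] S[OF I] unfolding s
      by (meson mult_left_mono order_trans zero_le)
    also have "\<dots> = ennreal (3 * len I * s)" using s by (simp add: ennreal_mult'')
    also have "\<dots> \<le> ennreal ((3 * s + e) * len I)"
      using l e by (intro ennreal_leI) (simp add: algebra_simps)
    finally show ?thesis .
  qed
  then have "Carl \<mu> \<le> ennreal (3 * s + e)"
    unfolding Carl_def using s e by (intro INF_lower) auto
  also have "\<dots> = 3 * S + ennreal e"
    using s e by (simp add: ennreal_mult)
  finally show "Carl \<mu> \<le> 3 * S + ennreal e" .
qed

section \<open>Comparison of the three quantities\<close>

theorem theorem2p3:
  shows "\<exists>c C :: real. 0 < c \<and> 0 < C \<and>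
    (\<forall>\<mu> :: (real \<times> real) measure. carleson_measure \<mu> \<longrightarrow>
      (let SE = (SUP E\<in>{E \<in> sets borel. E \<subseteq> upper_half_plane}.
                   BMOd_norm (dyadic_balayage (restrict_measure \<mu> E)));
           SQ = (SUP I\<in>dyadic_intervals.
                   BMOd_norm (dyadic_balayage (restrict_measure \<mu> (carleson_square I))))
       in ennreal c * Carl \<mu> \<le> SE \<and> SE \<le> ennreal C * Carl \<mu> \<and>
          ennreal c * SE \<le> SQ \<and> SQ \<le> ennreal C * SE))"
proof -
  \<comment> \<open>The chain \<open>SE \<le> 2 * Carl \<mu> \<le> 6 * SQ\<close> together with
    \<open>SQ \<le> SE\<close> gives all four inequalities; 1/6 is the reciprocal of the product of
    the constants 2 and 3.\<close>
  have "ennreal (1/6) * Carl \<mu> \<le> SE \<and> SE \<le> ennreal 2 * Carl \<mu> \<and>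
      ennreal (1/6) * SE \<le> SQ \<and> SQ \<le> ennreal 2 * SE"
    if \<mu>: "carleson_measure \<mu>"
      and SE: "SE = (SUP E\<in>{E \<in> sets borel. E \<subseteq> upper_half_plane}.
                   BMOd_norm (dyadic_balayage (restrict_measure \<mu> E)))"
      and SQ: "SQ = (SUP I\<in>dyadic_intervals.
                   BMOd_norm (dyadic_balayage (restrict_measure \<mu> (carleson_square I))))"
    for \<mu> SE SQ
  proof -
    have "SQ \<le> SE"
      unfolding SE SQ
      by (intro SUP_least SUP_upper)
        (auto simp: sets_borel_carleson_square carleson_square_subset_upper_half_plane[THEN subsetD])
    have SE_le: "SE \<le> 2 * Carl \<mu>"
      unfolding SE by (intro SUP_least) (use BMOd_norm_restrict_measure_le_Carl[OF \<mu>] in auto)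
    have Carl_le: "Carl \<mu> \<le> 3 * SQ"
      unfolding SQ by (intro Carl_le_of_BMOd_norm_le \<mu> SUP_upper)
    have scale: "ennreal (1/6) * x \<le> y" if "x \<le> 6 * y" for x y :: ennreal
    proof -
      have "ennreal (1/6) * x \<le> ennreal (1/6) * (ennreal 6 * y)"
        using that by (intro mult_left_mono) auto
      also have "\<dots> = y" by (simp add: mult.assoc[symmetric] ennreal_mult[symmetric] del: ennreal_numeral)
      finally show ?thesis .
    qed
    have "SE \<le> 2 * (3 * SQ)"
      using SE_le Carl_le by (meson mult_left_mono order_trans zero_le)
    then have "SE \<le> 6 * SQ" by (simp add: mult.assoc[symmetric])
    moreover have "Carl \<mu> \<le> 6 * SE"
    proof -
      have "3 * SQ \<le> 6 * SE" using \<open>SQ \<le> SE\<close> by (intro mult_mono) auto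
      with Carl_le show ?thesis by (rule order_trans)
    qed
    moreover have "SQ \<le> 2 * SE"
      using \<open>SQ \<le> SE\<close> mult_right_mono[of 1 2 SE] by (simp add: order_trans)
    ultimately show ?thesis using SE_le scale by simp
  qed
  then show ?thesis unfolding Let_def
    by (intro exI[of _ "1/6"] exI[of _ 2]) simp
qed

end
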